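(* Let $n\ge0$, $r\ge2$ be integers, let $\pi\in\mathbb Z_r\wr\mathfrak S_n$ and let $\mathcal T=T''(\pi)$. Then $$(\mathcal X(\mathcal T),c_0(\mathcal T),c_1(\mathcal T),\mathrm{yy}(\mathcal T))=(\mathcal X(\pi),\mathrm{zc}(\pi),\mathrm{nc}(\pi),\mathrm{yy}(\pi)),$$ where $\mathcal X(\pi)$ is regarded as an element of $\{0,1\}^n$.
   Context: Marked cycles and $T(\sigma,s)$: for a finite nonempty totally ordered set $S$, a marked cycle is $(\sigma,s)$ with $\sigma$ a cyclic permutation of $S$ and $s\in\{\min S,\max S\}$. Write $W=a_1\cdots a_m$, $m=|S|-1$, $a_j=\sigma^j(s)$. If $s=\min S$ let $x_k>\cdots>x_1$ be the right-to-left maxima of $W$ (letters larger than all letters to their right); if $s=\max S$ let $x_k<\cdots<x_1$ be the right-to-left minima of $W$. Then $W=W_kx_k\cdots W_1x_1$ for unique (possibly empty) words $W_i$. $T(\sigma,s)$ is defined recursively: a single vertex if $S=\{s\}$; otherwise root $s$ with children $x_1,\ldots,x_k$, the subtree at $x_i$ being $T(\sigma_i,x_i)$, where $\sigma_i$ is the cyclic permutation of the letters of $W_ix_i$ sending each letter to the next and $x_i$ to the first letter. Colored permutations: $\mathbb Z_r\wr\mathfrak S_n=\{(\kappa,\sigma):\kappa:[n]\to\mathbb Z_r,\ \sigma\in\mathfrak S_n\}$. For $\pi=(\kappa,\sigma)$, $i\in\mathcal X(\pi)$ iff $\sigma(i)>i$, or $\sigma(i)=i$ and $\kappa_i\ne0$.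 A cycle of $\sigma$ is a zero cycle if $\kappa_i=0$ for its maximal element $i$, and a non-zero cycle otherwise; $\mathrm{zc}(\pi)$ and $\mathrm{nc}(\pi)$ denote the numbers of zero cycles and non-zero cycles. The map $T''$: $T''(\pi)$ is the rooted tree on $\{0,1,\ldots,n+1\}$ with root $0$, whose vertices are colored: $0$ has color $1$, $n+1$ has color $0$, and $i\in[n]$ has color $\kappa_i$. The children of $0$ are $n+1$ and the maximal elements $s_1,\ldots,s_k$ of the zero cycles $\sigma_1,\ldots,\sigma_k$, with subtree at $s_i$ equal to $T(\sigma_i,s_i)$; the children of $n+1$ are the minimal elements $t_1,\ldots,t_\ell$ of the non-zero cycles $\tau_1,\ldots,\tau_\ell$, with subtree at $t_i$ equal to $T(\tau_i,t_i)$ (cycles regarded as cyclic permutations of their supports). Tree statistics (ignoring colors): $p(i)$ is the parent of non-root vertex $i$; $i$ is an excedance if $i<p(i)$; $\mathcal X(\mathcal T)\in\{0,1\}^n$ with $\mathcal X(\mathcal T)(i)=1$ iff $i\in[n]$ is an excedance; $\mathrm{yy}(\mathcal T)$ is the number of pairs $1\le i<j\le n$ with $p(j)<i<j<p(i)$; $c_0(\mathcal T)$ is the number of children of $0$ minus one; $c_1(\mathcal T)$ is the number of children of $n+1$. Finally $\mathrm{yy}(\pi):=\mathrm{yy}(T''(\pi))$. *)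

theory Defs
  imports
    "HOL-Library.FSet"
    "HOL-Combinatorics.Cycles"
    "HOL-Combinatorics.Orbits"
begin

section \<open>Unordered rooted trees\<close>

datatype 'a rtree = Node (root: 'a) (subtrees: "'a rtree fset")

text \<open>The set of pairs (child, parent).\<close>

primrec edges :: "'a rtree \<Rightarrow> ('a \<times> 'a) set" where
  "edges (Node a ts) =
     (\<lambda>t. (root t, a)) ` fset ts \<union> \<Union> (fset (edges |`| ts))"

definition parent :: "'a rtree \<Rightarrow> 'a \<Rightarrow> 'a" where
  "parent t v = (THE u. (v, u) \<in> edges t)"

definition children :: "'a rtree \<Rightarrow> 'a \<Rightarrow> 'a set" where
  "children t u = {v. (v, u) \<in> edges t}"


section \<open>The tree of a marked cycle\<close>

text \<open>
  For \<open>R = (>)\<close> (resp. \<open>R = (<)\<close>) the list \<open>rl_records R W\<close> consists of the right-to-left maxima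
  (resp. minima) \<open>x\<^sub>k, \<dots>, x\<^sub>1\<close> of the word \<open>W\<close>, and \<open>rl_blocks R W\<close> of the words
  \<open>W\<^sub>k x\<^sub>k, \<dots>, W\<^sub>1 x\<^sub>1\<close> with concatenation \<open>W\<close>; both in the order in which they occur in \<open>W\<close>.
\<close>

fun rl_records :: "('a \<Rightarrow> 'a \<Rightarrow> bool) \<Rightarrow> 'a list \<Rightarrow> 'a list" where
  "rl_records R [] = []"
| "rl_records R (a # w) =
     (if \<forall>y\<in>set w. R a y then a # rl_records R w else rl_records R w)"

fun rl_blocks :: "('a \<Rightarrow> 'a \<Rightarrow> bool) \<Rightarrow> 'a list \<Rightarrow> 'a list list" where
  "rl_blocks R [] = []"
| "rl_blocks R (a # w) =
     (if \<forall>y\<in>set w. R a y then [a] # rl_blocks R w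
      else (a # hd (rl_blocks R w)) # tl (rl_blocks R w))"

lemma rl_blocks_eq_Nil_iff [simp]: "rl_blocks R w = [] \<longleftrightarrow> w = []"
  by (cases w) auto

lemma concat_rl_blocks: "concat (rl_blocks R w) = w"
proof (induction w)
  case (Cons a w)
  then show ?case by (cases "rl_blocks R w") auto
qed simp

lemma rl_blocks_nonempty: "b \<in> set (rl_blocks R w) \<Longrightarrow> b \<noteq> []"
proof (induction w)
  case (Cons a w)
  then show ?case by (cases "rl_blocks R w") (auto split: if_splits)
qed simp

lemma map_last_rl_blocks: "map last (rl_blocks R w) = rl_records R w"
proof (induction w)
  case (Cons a w)
  show ?case
  proof (cases "\<forall>y\<in>set w. R a y")
    case False
    then obtain b bs where b: "rl_blocks R w = b # bs"
      by (cases "rl_blocks R w") auto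
    then have "b \<noteq> []" by (metis list.set_intros(1) rl_blocks_nonempty)
    then show ?thesis using False Cons.IH b by auto
  qed (use Cons.IH in auto)
qed simp

text \<open>The word \<open>W = \<sigma>(s) \<sigma>\<^sup>2(s) \<dots> \<sigma>\<^sup>m(s)\<close> with \<open>m = |S| - 1\<close>.\<close>

definition cycle_word :: "('a \<Rightarrow> 'a) \<Rightarrow> 'a set \<Rightarrow> 'a \<Rightarrow> 'a list" where
  "cycle_word \<sigma> S s = map (\<lambda>j. (\<sigma> ^^ j) s) [1..<card S]"

lemma card_rl_block_less:
  assumes "B \<in> set (rl_blocks R (cycle_word \<sigma> S s))"
  shows "card (set B) < card S"
proof -
  from assms obtain us vs where "rl_blocks R (cycle_word \<sigma> S s) = us @ B # vs"
    by (meson split_list)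
  then have "cycle_word \<sigma> S s = concat us @ B @ concat vs"
    by (metis concat_rl_blocks concat.simps(2) concat_append)
  then have "length B \<le> length (cycle_word \<sigma> S s)" by simp
  moreover have "length (cycle_word \<sigma> S s) = card S - 1" by (simp add: cycle_word_def)
  moreover have "B \<noteq> []" using assms by (rule rl_blocks_nonempty)
  ultimately show ?thesis using card_length[of B] by (cases B) auto
qed

text \<open>
  The tree \<open>T(\<sigma>, s)\<close> of a marked cycle: it is meaningful when \<open>\<sigma>\<close> is a cyclic permutation of the
  finite nonempty set \<open>S\<close> and \<open>s\<close> is the minimum or the maximum of \<open>S\<close>. The block \<open>B = W\<^sub>i x\<^sub>i\<close>
  contributes the subtree of the marked cycle \<open>(cycle_of_list B, last B)\<close> on the set of its letters.
\<close>

function cycle_tree :: "('a::linorder \<Rightarrow> 'a) \<Rightarrow> 'a set \<Rightarrow> 'a \<Rightarrow> 'a rtree" where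
  "cycle_tree \<sigma> S s =
     (if S = {s} then Node s {||}
      else Node s (fset_of_list
             (map (\<lambda>B. cycle_tree (cycle_of_list B) (set B) (last B))
               (rl_blocks (if s = Min S then (>) else (<)) (cycle_word \<sigma> S s)))))"
  by pat_completeness auto
termination
  by (relation "measure (\<lambda>(\<sigma>, S, s). card S)") (auto dest: card_rl_block_less)

declare cycle_tree.simps [simp del]


section \<open>Colored permutations\<close>

text \<open>
  The set underlying the wreath product of \<open>\<int>/r\<close> with the symmetric group on \<open>{1..n}\<close>, with residue
  classes represented by \<open>0, \<dots>, r - 1\<close>.
\<close>

type_synonym colored_perm = "(nat \<Rightarrow> nat) \<times> (nat \<Rightarrow> nat)"

definition colored_perms :: "nat \<Rightarrow> nat \<Rightarrow> colored_perm set" where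
  "colored_perms r n =
     {(\<kappa>, \<sigma>). \<kappa> \<in> {1..n} \<rightarrow>\<^sub>E {0..<r} \<and> \<sigma> permutes {1..n}}"

fun excedances :: "nat \<Rightarrow> colored_perm \<Rightarrow> nat set" where
  "excedances n (\<kappa>, \<sigma>) = {i \<in> {1..n}. \<sigma> i > i \<or> (\<sigma> i = i \<and> \<kappa> i \<noteq> 0)}"

text \<open>A cycle of \<open>\<sigma>\<close> is given by its support \<open>C\<close>; the corresponding cyclic permutation of \<open>C\<close>
  is \<open>perm_restrict \<sigma> C\<close>. Fixed points are cycles.\<close>

definition cycle_supports :: "nat \<Rightarrow> (nat \<Rightarrow> nat) \<Rightarrow> nat set set" where
  "cycle_supports n \<sigma> = orbit \<sigma> ` {1..n}"

fun zero_cycles :: "nat \<Rightarrow> colored_perm \<Rightarrow> nat set set" where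
  "zero_cycles n (\<kappa>, \<sigma>) = {C \<in> cycle_supports n \<sigma>. \<kappa> (Max C) = 0}"

fun nonzero_cycles :: "nat \<Rightarrow> colored_perm \<Rightarrow> nat set set" where
  "nonzero_cycles n (\<kappa>, \<sigma>) = {C \<in> cycle_supports n \<sigma>. \<kappa> (Max C) \<noteq> 0}"

definition zc :: "nat \<Rightarrow> colored_perm \<Rightarrow> nat" where
  "zc n \<pi> = card (zero_cycles n \<pi>)"

definition nc :: "nat \<Rightarrow> colored_perm \<Rightarrow> nat" where
  "nc n \<pi> = card (nonzero_cycles n \<pi>)"


section \<open>The map $T''$\<close>

type_synonym colored_tree = "nat rtree \<times> (nat \<Rightarrow> nat)"

fun T'' :: "nat \<Rightarrow> colored_perm \<Rightarrow> colored_tree" where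
  "T'' n (\<kappa>, \<sigma>) =
     (Node 0 (finsert
        (Node (n + 1) (Abs_fset
           ((\<lambda>C. cycle_tree (perm_restrict \<sigma> C) C (Min C)) ` nonzero_cycles n (\<kappa>, \<sigma>))))
        (Abs_fset
           ((\<lambda>C. cycle_tree (perm_restrict \<sigma> C) C (Max C)) ` zero_cycles n (\<kappa>, \<sigma>)))),
      \<lambda>v\<in>{0..n + 1}. if v = 0 then 1 else if v = n + 1 then 0 else \<kappa> v)"


section \<open>Statistics on trees with vertex set \<open>{0..n + 1}\<close>\<close>

definition tree_excedances :: "nat \<Rightarrow> colored_tree \<Rightarrow> nat set" where
  "tree_excedances n \<T> = {i \<in> {1..n}. i < parent (fst \<T>) i}"

text \<open>A subset of \<open>{1..n}\<close> as an element of \<open>{0,1}\<^sup>n\<close>.\<close>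

definition indicator_vec :: "nat \<Rightarrow> nat set \<Rightarrow> nat \<Rightarrow> nat" where
  "indicator_vec n A = (\<lambda>i\<in>{1..n}. if i \<in> A then 1 else 0)"

definition yy :: "nat \<Rightarrow> colored_tree \<Rightarrow> nat" where
  "yy n \<T> = card {(i, j). 1 \<le> i \<and> i < j \<and> j \<le> n \<and>
     parent (fst \<T>) j < i \<and> j < parent (fst \<T>) i}"

definition c\<^sub>0 :: "colored_tree \<Rightarrow> int" where
  "c\<^sub>0 \<T> = int (card (children (fst \<T>) 0)) - 1"

definition c\<^sub>1 :: "nat \<Rightarrow> colored_tree \<Rightarrow> nat" where
  "c\<^sub>1 n \<T> = card (children (fst \<T>) (n + 1))"

definition yy_perm :: "nat \<Rightarrow> colored_perm \<Rightarrow> nat" where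
  "yy_perm n \<pi> = yy n (T'' n \<pi>)"

end

(* The key point is that a non-root vertex v of T(sigma, s) satisfies v < p(v) iff v < sigma(v).
   Write the cycle as the word W s = W_k x_k ... W_1 x_1 s. If s is the minimum, then p(x_i) = s < x_i,
   and sigma(x_i) is either s or a letter to the right of the record x_i, so it is smaller than x_i
   as well; every other letter is followed within its own block, of which x_i is the maximum, so
   induction on the word applies. The case of the maximum is dual. In T''(pi) the marked elements hang
   below 0 resp. n + 1, which makes the maximum of a zero cycle a non-excedance and the minimum
   of a non-zero cycle an excedance, fixed points included. *)

theory Submission
  imports Defs
begin

section \<open>Edges of rooted trees\<close>

lemma edges_Node: "edges (Node a ts) = (\<lambda>t. (root t, a)) ` fset ts \<union> (\<Union>t\<in>fset ts. edges t)"
  by simp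

declare edges.simps [simp del]

lemma set_rtree_Node: "set_rtree (Node a ts) = insert a (\<Union>t\<in>fset ts. set_rtree t)"
  by simp

lemma root_in_set_rtree: "root t \<in> set_rtree t"
  by (cases t) simp

lemma edges_subset_set_rtree: "edges t \<subseteq> set_rtree t \<times> set_rtree t"
proof (induction t)
  case (Node a ts)
  then show ?case using root_in_set_rtree by (fastforce simp: edges_Node)
qed

text \<open>Existence half of having a parent; uniqueness comes separately from
  \<open>simple_tree\<close>.\<close>

lemma child_or_root: "v \<in> set_rtree t \<Longrightarrow> v = root t \<or> v \<in> Domain (edges t)"
proof (induction t)
  case (Node a ts)
  show ?case
  proof (cases "v = a")
    case False
    then obtain t where t: "t \<in> fset ts" "v \<in> set_rtree t" using Node.prems by auto
    then have "v = root t \<or> v \<in> Domain (edges t)" using Node.IH by blast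
    with t(1) show ?thesis unfolding edges_Node by blast
  qed simp
qed

text \<open>The datatype allows a label to occur several times. Since edges are pairs (child,
  parent), single-valuedness leaves each label at most one parent, which is what the
  \<open>THE\<close> in \<open>parent\<close> needs.\<close>

definition simple_tree :: "'a rtree \<Rightarrow> bool" where
  "simple_tree t \<longleftrightarrow> single_valued (edges t) \<and> root t \<notin> Domain (edges t)"

text \<open>Indexed by the trees themselves, because the children of a node form a set without
  positions or multiplicities.\<close>

definition disjoint_forest :: "'a rtree set \<Rightarrow> bool" where
  "disjoint_forest A \<longleftrightarrow> (\<forall>t\<in>A. \<forall>t'\<in>A. t \<noteq> t' \<longrightarrow> set_rtree t \<inter> set_rtree t' = {})"

lemma disjoint_forest_image:
  assumes "\<And>x y v. x \<in> A \<Longrightarrow> y \<in> A \<Longrightarrow> v \<in> set_rtree (f x) \<Longrightarrow> v \<in> set_rtree (f y) \<Longrightarrow> x = y"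
  shows "disjoint_forest (f ` A)"
  unfolding disjoint_forest_def using assms by blast

lemma disjoint_forest_insert:
  assumes "disjoint_forest A" and "\<And>t' v. t' \<in> A \<Longrightarrow> v \<in> set_rtree t \<Longrightarrow> v \<notin> set_rtree t'"
  shows "disjoint_forest (insert t A)"
  using assms unfolding disjoint_forest_def by blast

text \<open>By disjointness all edges leaving a vertex \<open>v\<close> come from one subtree
  \<open>t\<close>: they are edges of \<open>t\<close>, or \<open>v\<close> is the root of
  \<open>t\<close> and the edge goes to \<open>a\<close>. The two kinds never meet, as the root of
  \<open>t\<close> has no parent inside \<open>t\<close>.\<close>

lemma simple_tree_Node:
  assumes simple: "\<And>t. t \<in> fset ts \<Longrightarrow> simple_tree t"
    and disj: "disjoint_forest (fset ts)"
    and a: "\<And>t. t \<in> fset ts \<Longrightarrow> a \<notin> set_rtree t"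
  shows "simple_tree (Node a ts)"
proof -
  have same: "t = t'" if "t \<in> fset ts" "t' \<in> fset ts" "v \<in> set_rtree t" "v \<in> set_rtree t'" for t t' v
    using disj that unfolding disjoint_forest_def by blast
  have edge: "v \<in> set_rtree t" if "(v, u) \<in> edges t" for v u t
    using edges_subset_set_rtree that by fast
  have split: "\<exists>t\<in>fset ts. v \<in> set_rtree t \<and> ((v, u) \<in> edges t \<or> v = root t \<and> u = a)"
    if "(v, u) \<in> edges (Node a ts)" for v u
  proof -
    from that obtain t where "t \<in> fset ts" "(v, u) = (root t, a) \<or> (v, u) \<in> edges t"
      unfolding edges_Node by blast
    then show ?thesis using edge root_in_set_rtree by (metis Pair_inject)
  qed
  have "u = u'" if vu: "(v, u) \<in> edges (Node a ts)" "(v, u') \<in> edges (Node a ts)" for v u u'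
  proof -
    obtain t where t: "t \<in> fset ts" "(v, u) \<in> edges t \<or> v = root t \<and> u = a"
      "(v, u') \<in> edges t \<or> v = root t \<and> u' = a"
      using vu [THEN split] same by metis
    then show ?thesis
      using simple [OF t(1)] unfolding simple_tree_def by (auto dest: single_valuedD)
  qed
  moreover have "a \<notin> Domain (edges (Node a ts))"
  proof
    assume "a \<in> Domain (edges (Node a ts))"
    then obtain t where "t \<in> fset ts" "a \<in> set_rtree t" using split by blast
    with a show False by blast
  qed
  ultimately show ?thesis
    unfolding simple_tree_def single_valued_def by simp
qed

lemma parent_eq:
  assumes "single_valued (edges t)" and "(v, u) \<in> edges t"
  shows "parent t v = u"
  unfolding parent_def using assms by (auto dest: single_valuedD)

lemma children_root:
  assumes "\<And>t. t \<in> fset ts \<Longrightarrow> a \<notin> set_rtree t"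
  shows "children (Node a ts) a = root ` fset ts"
proof -
  have "(v, a) \<notin> edges t" if "t \<in> fset ts" for v t
    using assms [OF that] edges_subset_set_rtree [of t] by blast
  then show ?thesis unfolding children_def edges_Node by blast
qed


section \<open>Right-to-left records\<close>

text \<open>If a block ends between the neighbours \<open>v\<close> and \<open>u\<close>, then
  \<open>v\<close> is a record and \<open>u\<close> is a later letter or \<open>s\<close>; otherwise
  both lie in one block. The appended \<open>s\<close> gives the last letter of \<open>w\<close> a
  neighbour too.\<close>

lemma rl_blocks_adjacent:
  assumes "w @ [s] = xs @ v # u # ys" and "\<And>y. y \<in> set w \<Longrightarrow> R y s"
  shows "(v \<in> last ` set (rl_blocks R w) \<and> R v u) \<or>
    (\<exists>b\<in>set (rl_blocks R w). \<exists>xs' ys'. b = xs' @ v # u # ys')"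
  using assms
proof (induction w arbitrary: xs)
  case (Cons a w)
  show ?case
  proof (cases xs)
    case Nil
    then have [simp]: "v = a" and w: "w @ [s] = u # ys" using Cons.prems by auto
    show ?thesis
    proof (cases "\<forall>y\<in>set w. R a y")
      case True
      then have "R a u" using w Cons.prems(2) by (cases w) auto
      with True show ?thesis by (force simp: image_iff)
    next
      case False
      then obtain b bs where b: "rl_blocks R w = b # bs"
        by (cases "rl_blocks R w") auto
      \<comment> \<open>Here \<open>a\<close> is no record, so it joins the first block
        \<open>b\<close> of \<open>w\<close>, whose first letter is \<open>u\<close>.\<close>
      then have "b \<noteq> []" by (metis list.set_intros(1) rl_blocks_nonempty)
      moreover have "w = concat (b # bs)" using b concat_rl_blocks by metis
      ultimately obtain zs where "b = u # zs" using w by (cases b) auto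
      then have "a # b = [] @ v # u # zs" by simp
      moreover have "rl_blocks R (a # w) = (a # b) # bs"
        using False b by (simp only: rl_blocks.simps if_False list.sel)
      then have "a # b \<in> set (rl_blocks R (a # w))" by simp
      ultimately show ?thesis by blast
    qed
  next
    case (Cons a' xs')
    then have "w @ [s] = xs' @ v # u # ys" using Cons.prems by simp
    note IH = Cons.IH [OF this]
    show ?thesis
    proof (cases "\<forall>y\<in>set w. R a y")
      case True
      then show ?thesis using IH Cons.prems(2) by auto
    next
      case False
      then obtain b bs where b: "rl_blocks R w = b # bs"
        by (cases "rl_blocks R w") auto
      then have "b \<noteq> []" by (metis list.set_intros(1) rl_blocks_nonempty)
      moreover have blocks: "rl_blocks R (a # w) = (a # b) # bs"
        using False b by (simp only: rl_blocks.simps if_False list.sel)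
      \<comment> \<open>Lengthening the first block on the left changes neither its last letter nor
        the factors it contains, so both alternatives carry over from \<open>w\<close>.\<close>
      ultimately have lasts: "last ` set (rl_blocks R (a # w)) = last ` set (rl_blocks R w)"
        using b by simp
      have ext: "\<exists>c\<in>set (rl_blocks R (a # w)). \<exists>zs. c = zs @ d" if "d \<in> set (rl_blocks R w)" for d
      proof (cases "d = b")
        case True
        then have "a # b = [a] @ d" by simp
        then show ?thesis unfolding blocks by (meson list.set_intros(1))
      next
        case False
        then have "d \<in> set (rl_blocks R (a # w))" using that b blocks by simp
        moreover have "d = [] @ d" by simp
        ultimately show ?thesis by blast
      qed
      from IH Cons.prems(2) consider "v \<in> last ` set (rl_blocks R w)" "R v u"
        | d xs' ys' where "d \<in> set (rl_blocks R w)" "d = xs' @ v # u # ys'"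
        by auto
      then show ?thesis
      proof cases
        case 1
        then show ?thesis using lasts by blast
      next
        case 2
        with ext obtain c zs where "c \<in> set (rl_blocks R (a # w))" "c = (zs @ xs') @ v # u # ys'"
          by fastforce
        then show ?thesis by blast
      qed
    qed
  qed
qed simp

text \<open>The first block ends in the leftmost record, the extremum of the whole word: a prepended
  non-record is beaten by some later letter \<open>z\<close>, hence by that record through
  transitivity.\<close>

lemma last_hd_rl_blocks_extremal:
  assumes "transp R" and "totalp R" and "distinct w" and "y \<in> set w"
  shows "y = last (hd (rl_blocks R w)) \<or> R (last (hd (rl_blocks R w))) y"
  using assms(3,4)
proof (induction w arbitrary: y)
  case (Cons a w)
  show ?case
  proof (cases "\<forall>y\<in>set w. R a y")
    case False
    then obtain z where z: "z \<in> set w" "\<not> R a z" by blast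
    then have "R z a" using totalpD [OF \<open>totalp R\<close>, of a z] Cons.prems(1) by auto
    moreover from z have "hd (rl_blocks R w) \<noteq> []"
      by (metis empty_iff empty_set hd_in_set rl_blocks_eq_Nil_iff rl_blocks_nonempty)
    ultimately show ?thesis
      using Cons False z \<open>transp R\<close> by (auto dest: transpD)
  qed (use Cons in auto)
qed simp

text \<open>Ensures that each block marked at its last letter is again a marked cycle. A block of
  \<open>a # w\<close> is a block of \<open>w\<close> or the first one, where the preceding lemma
  applies.\<close>

lemma last_rl_blocks_extremal:
  assumes "transp R" and "totalp R" and "distinct w"
    and "b \<in> set (rl_blocks R w)" and "y \<in> set b"
  shows "y = last b \<or> R (last b) y"
  using assms(3-5)
proof (induction w)
  case (Cons a w)
  show ?case
  proof (cases "\<forall>y\<in>set w. R a y")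
    case False
    then have "w \<noteq> []" by auto
    have "set (tl (rl_blocks R w)) \<subseteq> set (rl_blocks R w)"
      by (metis list.set_sel(2) subsetI tl_Nil)
    moreover have "rl_blocks R (a # w) = (a # hd (rl_blocks R w)) # tl (rl_blocks R w)"
      using False by (simp only: rl_blocks.simps if_False)
    ultimately consider "b \<in> set (rl_blocks R w)" | "b = hd (rl_blocks R (a # w))"
      using Cons.prems(2) by auto
    then show ?thesis
    proof cases
      case 1
      then show ?thesis using Cons by simp
    next
      case 2
      then have "y \<in> set (a # w)"
        using Cons.prems(2,3) concat_rl_blocks [of R "a # w"]
        by (metis UN_I set_concat)
      with 2 show ?thesis
        using last_hd_rl_blocks_extremal [OF assms(1,2) Cons.prems(1)] by blast
    qed
  qed (use Cons in auto)
qed simp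

lemma set_rl_block_subset: "b \<in> set (rl_blocks R w) \<Longrightarrow> set b \<subseteq> set w"
  by (metis UN_upper concat_rl_blocks set_concat)

lemma length_rl_block_le:
  assumes "b \<in> set (rl_blocks R w)"
  shows "length b \<le> length w"
proof -
  obtain us vs where "rl_blocks R w = us @ b # vs" using assms by (meson split_list)
  then have "w = concat us @ b @ concat vs"
    by (metis concat.simps(2) concat_append concat_rl_blocks)
  then show ?thesis by (metis length_append le_add1 le_add2 le_trans)
qed

lemma UN_set_rl_blocks: "(\<Union>b\<in>set (rl_blocks R w). set b) = set w"
  by (metis concat_rl_blocks set_concat)

lemma distinct_rl_block:
  assumes "distinct w" and "b \<in> set (rl_blocks R w)"
  shows "distinct b"
  by (metis assms concat_rl_blocks distinct_concat_iff)

lemma disjoint_rl_blocks: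
  assumes "distinct w" and "b \<in> set (rl_blocks R w)" and "c \<in> set (rl_blocks R w)" and "b \<noteq> c"
  shows "set b \<inter> set c = {}"
  by (metis assms concat_rl_blocks distinct_concat_iff)


section \<open>Trees of words\<close>

text \<open>This is the recursive call made inside \<open>cycle_tree\<close>; with a name for it the
  recursion runs over words alone.\<close>

definition word_tree :: "'a::linorder list \<Rightarrow> 'a rtree" where
  "word_tree B = cycle_tree (cycle_of_list B) (set B) (last B)"

text \<open>From the last position, \<open>Suc i\<close> cyclic steps wrap around to position
  \<open>i\<close>; \<open>cyclic_rotation\<close> expresses the steps as a rotation of
  \<open>B\<close>.\<close>

lemma cycle_word_cycle_of_list:
  assumes "distinct B" and "B \<noteq> []"
  shows "cycle_word (cycle_of_list B) (set B) (last B) = butlast B"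
proof (rule nth_equalityI)
  show "length (cycle_word (cycle_of_list B) (set B) (last B)) = length (butlast B)"
    using assms by (simp add: cycle_word_def distinct_card)
next
  fix i
  assume "i < length (cycle_word (cycle_of_list B) (set B) (last B))"
  then have i: "Suc i < length B"
    using assms by (simp add: cycle_word_def distinct_card)
  have "(cycle_of_list B ^^ Suc i) (last B) = map (cycle_of_list B ^^ Suc i) B ! (length B - 1)"
    using assms by (simp add: last_conv_nth)
  also have "\<dots> = rotate (Suc i) B ! (length B - 1)"
    using assms by (simp only: cyclic_rotation)
  also have "\<dots> = B ! ((length B - 1 + Suc i) mod length B)"
    using assms by (subst nth_rotate) (auto simp: add.commute)
  also have "length B - 1 + Suc i = length B + i" using i by simp
  also have "B ! ((length B + i) mod length B) = B ! i" using i by simp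
  finally have "(cycle_of_list B ^^ Suc i) (last B) = B ! i" .
  moreover have "[1..<length B] ! i = Suc i" using i by (subst nth_upt) auto
  ultimately show "cycle_word (cycle_of_list B) (set B) (last B) ! i = butlast B ! i"
    using i assms by (simp add: cycle_word_def distinct_card nth_butlast del: funpow.simps upt_Suc)
qed

text \<open>One unfolding of \<open>cycle_tree\<close> uses the permutation only through its
  \<open>cycle_word\<close>; all deeper calls depend on the blocks alone.\<close>

lemma cycle_tree_eq_word_tree:
  assumes "distinct B" and "B \<noteq> []" and "cycle_word \<sigma> (set B) (last B) = butlast B"
  shows "cycle_tree \<sigma> (set B) (last B) = word_tree B"
  unfolding word_tree_def
  by (subst (1 2) cycle_tree.simps) (simp add: assms cycle_word_cycle_of_list)

lemma last_notin_butlast: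
  assumes "distinct B" and "B \<noteq> []"
  shows "last B \<notin> set (butlast B)"
  using assms by (cases B rule: rev_cases) auto

lemma set_eq_insert_last:
  assumes "B \<noteq> []"
  shows "set B = insert (last B) (set (butlast B))"
  using assms by (cases B rule: rev_cases) auto

text \<open>Merges the single-vertex case into the general one: there \<open>butlast B\<close> is
  empty and has no blocks.\<close>

lemma word_tree_unfold:
  assumes "distinct B" and "B \<noteq> []"
  shows "word_tree B = Node (last B) (fset_of_list
    (map word_tree (rl_blocks (if last B = Min (set B) then (>) else (<)) (butlast B))))"
proof (cases "set B = {last B}")
  case True
  then have "set (butlast B) \<subseteq> {last B}"
    using set_eq_insert_last [OF assms(2)] by (metis subset_insertI)
  then have "set (butlast B) = {}"
    using last_notin_butlast [OF assms] by (metis insertI1 subset_singletonD)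
  then have "butlast B = []" by simp
  moreover have "cycle_tree (cycle_of_list B) (set B) (last B) = Node (last B) {||}"
    using True by (subst cycle_tree.simps) (simp only: simp_thms if_True)
  ultimately show ?thesis unfolding word_tree_def by simp
next
  case False
  then show ?thesis
    unfolding word_tree_def
    by (subst cycle_tree.simps) (simp only: if_False cycle_word_cycle_of_list [OF assms])
qed

lemma root_word_tree:
  assumes "distinct B" and "B \<noteq> []"
  shows "root (word_tree B) = last B"
  by (simp add: word_tree_unfold assms)

text \<open>Both claims go through one induction on the length, since simplicity of a node needs the
  label sets of its subtrees. The blocks are shorter than \<open>B\<close> and partition the letters
  of \<open>butlast B\<close>.\<close>

lemma word_tree_simple:
  assumes "distinct B" and "B \<noteq> []"
  shows "set_rtree (word_tree B) = set B \<and> simple_tree (word_tree B)"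
  using assms
proof (induction B rule: length_induct)
  case (1 B)
  define bs where "bs = rl_blocks (if last B = Min (set B) then (>) else (<)) (butlast B)"
  have dist: "distinct (butlast B)" using 1 by (simp add: distinct_butlast)
  have last: "last B \<notin> set (butlast B)"
    using 1(2,3) by (rule last_notin_butlast)
  have B: "set B = insert (last B) (set (butlast B))"
    using 1(3) by (rule set_eq_insert_last)
  have tree: "word_tree B = Node (last B) (fset_of_list (map word_tree bs))"
    using 1 word_tree_unfold bs_def by blast
  have IH: "set_rtree (word_tree b) = set b" "simple_tree (word_tree b)" if "b \<in> set bs" for b
  proof -
    have "length b < length B"
      using length_rl_block_le [OF that [unfolded bs_def]] 1(3) by (cases B rule: rev_cases) auto
    then show "set_rtree (word_tree b) = set b" "simple_tree (word_tree b)"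
      using 1(1) that distinct_rl_block [OF dist] rl_blocks_nonempty unfolding bs_def by blast+
  qed
  have un: "(\<Union>b\<in>set bs. set b) = set (butlast B)"
    unfolding bs_def by (rule UN_set_rl_blocks)
  have "set_rtree (word_tree B) = insert (last B) (\<Union>b\<in>set bs. set b)"
    unfolding tree by (simp add: fset_of_list.rep_eq IH)
  then have "set_rtree (word_tree B) = set B" using un B by simp
  moreover have "simple_tree (word_tree B)"
    unfolding tree
  proof (rule simple_tree_Node)
    show "disjoint_forest (fset (fset_of_list (map word_tree bs)))"
      unfolding disjoint_forest_def
      using disjoint_rl_blocks [OF dist] IH(1) bs_def
      by (auto simp: fset_of_list.rep_eq)
  qed (use IH un last in \<open>auto simp: fset_of_list.rep_eq\<close>)
  ultimately show ?case ..
qed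

lemma set_word_tree: "distinct B \<Longrightarrow> B \<noteq> [] \<Longrightarrow> set_rtree (word_tree B) = set B"
  and simple_word_tree: "distinct B \<Longrightarrow> B \<noteq> [] \<Longrightarrow> simple_tree (word_tree B)"
  using word_tree_simple by blast+

text \<open>The letter \<open>u\<close> following \<open>v\<close> is its image under the cycle read
  off \<open>B\<close>; stated with words, the claim passes directly to the blocks. The mark ends
  \<open>B\<close>, so \<open>u\<close> may be the mark while \<open>v\<close> may not.\<close>

lemma word_tree_excedance:
  assumes "distinct B" and "last B \<in> {Min (set B), Max (set B)}"
    and "B = xs @ v # u # ys" and "(v, p) \<in> edges (word_tree B)"
  shows "v < p \<longleftrightarrow> v < u"
  using assms
proof (induction B arbitrary: xs ys rule: length_induct)
  case (1 B)
  note IH = 1(1) and dist_B = 1(2) and last_B = 1(3) and B = 1(4) and edge = 1(5)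
  define R :: "'a \<Rightarrow> 'a \<Rightarrow> bool" where "R = (if last B = Min (set B) then (>) else (<))"
  define bs where "bs = rl_blocks R (butlast B)"
  have ne: "B \<noteq> []" using B by auto
  have R: "transp R" "totalp R" by (auto simp: R_def)
  have dist: "distinct (butlast B)" using dist_B by (simp add: distinct_butlast)
  have last: "last B \<notin> set (butlast B)"
    using dist_B ne by (rule last_notin_butlast)
  \<comment> \<open>\<open>R\<close> is (>) for a minimal mark and (<) for a maximal one, so either
    way every other letter is in relation \<open>R\<close> to the mark.\<close>
  have R_last: "R y (last B)" if "y \<in> set (butlast B)" for y
  proof -
    have "y \<in> set B" "y \<noteq> last B" using that last in_set_butlastD by fast+
    moreover from this have "Min (set B) \<le> y" "y \<le> Max (set B)" by auto
    ultimately show ?thesis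
      using last_B unfolding R_def by (cases "last B = Min (set B)") (metis le_neq_trans insertE singletonD)+
  qed
  have tree: "word_tree B = Node (last B) (fset_of_list (map word_tree bs))"
    using dist_B ne word_tree_unfold bs_def R_def by blast
  have sv: "single_valued (edges (word_tree B))"
    using dist_B ne simple_word_tree simple_tree_def by blast
  have bs: "distinct b" "b \<noteq> []" if "b \<in> set bs" for b
    using that distinct_rl_block [OF dist] rl_blocks_nonempty unfolding bs_def by blast+
  have "butlast B @ [last B] = xs @ v # u # ys"
    by (rule trans [OF append_butlast_last_id [OF ne] B])
  then consider "v \<in> last ` set bs" "R v u"
    | b xs' ys' where "b \<in> set bs" "b = xs' @ v # u # ys'"
    using rl_blocks_adjacent [of "butlast B" "last B" xs v u ys R] R_last unfolding bs_def by blast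
  then show ?case
  proof cases
    case 1
    \<comment> \<open>A record is a child of the mark, so \<open>p\<close> is the mark;
      \<open>R v p\<close> and \<open>R v u\<close> then decide both comparisons alike.\<close>
    then obtain b where b: "b \<in> set bs" "v = last b" by blast
    then have "(v, last B) \<in> edges (word_tree B)"
      unfolding tree edges_Node using root_word_tree [OF bs] by (force simp: fset_of_list.rep_eq)
    then have "p = last B" using sv edge by (metis single_valuedD)
    moreover have "v \<in> set (butlast B)"
      using b bs set_rl_block_subset unfolding bs_def by (metis last_in_set subsetD)
    ultimately have "R v p" using R_last by blast
    with \<open>R v u\<close> show ?thesis unfolding R_def by (auto split: if_splits)
  next
    case 2
    \<comment> \<open>Not being the root of its block tree, \<open>v\<close> has a parent
      \<open>q\<close> there, which single-valuedness identifies with \<open>p\<close>.\<close>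
    have "v \<noteq> last b" using bs(1) [OF 2(1)] unfolding 2(2) by (auto dest: last_in_set)
    moreover have "v \<in> set b" using 2 by simp
    ultimately obtain q where q: "(v, q) \<in> edges (word_tree b)"
      using child_or_root [of v "word_tree b"] root_word_tree set_word_tree bs 2(1) by blast
    then have "(v, q) \<in> edges (word_tree B)"
      unfolding tree edges_Node using 2(1) by (auto simp: fset_of_list.rep_eq)
    then have "q = p" using sv edge by (metis single_valuedD)
    \<comment> \<open>The kind of mark alternates: blocks below a minimum are marked at their
      maximum, and conversely.\<close>
    moreover have "last b \<in> {Min (set b), Max (set b)}"
    proof -
      have ext: "y = last b \<or> R (last b) y" if "y \<in> set b" for y
        using last_rl_blocks_extremal [OF R dist] 2(1) that unfolding bs_def by blast
      have in_b: "last b \<in> set b" using bs 2(1) by simp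
      show ?thesis
      proof (cases "last B = Min (set B)")
        case True
        then have "Max (set b) = last b"
          using ext in_b by (intro Max_eqI) (fastforce simp: R_def)+
        then show ?thesis by simp
      next
        case False
        then have "Min (set b) = last b"
          using ext in_b by (intro Min_eqI) (fastforce simp: R_def)+
        then show ?thesis by simp
      qed
    qed
    moreover have "length b < length B"
      using length_rl_block_le [OF 2(1) [unfolded bs_def]] ne by (cases B rule: rev_cases) auto
    ultimately show ?thesis using IH bs(1) 2 q by blast
  qed
qed


section \<open>Trees of cyclic permutations\<close>

text \<open>\<open>L\<close> runs through the orbit starting at \<open>s\<close>; one rotation moves
  \<open>s\<close> to the end, so the word followed by its mark inherits distinctness and letters
  from \<open>L\<close>.\<close>

lemma cyclic_on_rotate1_funpow:
  assumes "cyclic_on f S" and "s \<in> S"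
  defines "L \<equiv> map (\<lambda>j. (f ^^ j) s) [0..<card S]"
  shows "distinct L" and "set L = S" and "rotate1 L = cycle_word f S s @ [s]"
    and "(f ^^ card S) s = s"
proof -
  have S: "S = orbit f s" and s: "s \<in> orbit f s"
    using assms(1,2) orbit_cyclic_eq3 by metis+
  \<comment> \<open>The witness is \<open>funpow_dist1 f s s\<close>, the least positive period of
    \<open>s\<close>, which turns out to be \<open>card S\<close>.\<close>
  obtain d where d: "inj_on (\<lambda>j. (f ^^ j) s) {0..<d}" "S = (\<lambda>j. (f ^^ j) s) ` {0..<d}"
      "(f ^^ d) s = s"
    using inj_on_funpow_dist1 [OF s] orbit_conv_funpow_dist1 [OF s] funpow_dist1_prop [OF s] S
    by metis
  then have "card S = d" using card_image [OF d(1)] by simp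
  then show "distinct L" "set L = S" "(f ^^ card S) s = s"
    using d unfolding L_def by (simp_all add: distinct_map)
  have "card S > 0"
    using finite_cyclic_on [OF assms(1)] assms(2) card_gt_0_iff by blast
  then show "rotate1 L = cycle_word f S s @ [s]"
    unfolding L_def cycle_word_def by (simp add: upt_conv_Cons)
qed

lemma distinct_cycle_word:
  assumes "cyclic_on f S" and "s \<in> S"
  shows "distinct (cycle_word f S s @ [s])" and "set (cycle_word f S s @ [s]) = S"
  using cyclic_on_rotate1_funpow [OF assms] by (metis distinct1_rotate, metis set_rotate1)

lemma cycle_word_adjacent:
  assumes "cyclic_on f S" and "s \<in> S" and B: "cycle_word f S s @ [s] = xs @ v # u # ys"
  shows "u = f v"
proof -
  have "card S > 0"
    using finite_cyclic_on [OF assms(1)] assms(2) card_gt_0_iff by blast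
  then have len: "length (cycle_word f S s @ [s]) = card S"
    by (simp add: cycle_word_def)
  \<comment> \<open>The word starts at \<open>f s\<close>, hence the shift by one; the final entry
    \<open>s\<close> fits because \<open>f ^^ card S\<close> fixes it.\<close>
  have nth: "(cycle_word f S s @ [s]) ! j = (f ^^ Suc j) s" if "j < card S" for j
  proof (cases "Suc j = card S")
    case True
    then show ?thesis
      using cyclic_on_rotate1_funpow(4) [OF assms(1,2)]
      by (simp add: nth_append cycle_word_def del: funpow.simps upt_Suc flip: True)
  next
    case False
    then have "j < card S - 1" using that by simp
    then show ?thesis
      by (simp add: nth_append cycle_word_def del: funpow.simps upt_Suc)
  qed
  have "Suc (length xs) < card S" using len unfolding B by simp
  moreover have "(xs @ v # u # ys) ! length xs = v" "(xs @ v # u # ys) ! Suc (length xs) = u"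
    by (simp_all add: nth_append)
  ultimately show ?thesis
    using nth [of "length xs"] nth [of "Suc (length xs)"] unfolding B by simp
qed

text \<open>Appending the mark puts it in last position, where \<open>word_tree\<close> looks for
  it.\<close>

lemma cycle_tree_cyclic:
  assumes "cyclic_on f S" and "s \<in> S"
  shows "cycle_tree f S s = word_tree (cycle_word f S s @ [s])"
  using cycle_tree_eq_word_tree [of "cycle_word f S s @ [s]" f] distinct_cycle_word [OF assms]
  by simp

lemma root_cycle_tree: "root (cycle_tree f S s) = s"
  by (subst cycle_tree.simps) simp

lemma set_cycle_tree: "cyclic_on f S \<Longrightarrow> s \<in> S \<Longrightarrow> set_rtree (cycle_tree f S s) = S"
  using cycle_tree_cyclic distinct_cycle_word set_word_tree by (metis snoc_eq_iff_butlast)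

lemma simple_cycle_tree: "cyclic_on f S \<Longrightarrow> s \<in> S \<Longrightarrow> simple_tree (cycle_tree f S s)"
  using cycle_tree_cyclic distinct_cycle_word simple_word_tree by (metis snoc_eq_iff_butlast)

text \<open>A vertex with a parent is not the root \<open>s\<close>, so it occurs in the word and is
  followed by its image under \<open>f\<close>; the comparison for words then applies.\<close>

lemma cycle_tree_excedance:
  assumes cyc: "cyclic_on f S" and s: "s \<in> S" "s \<in> {Min S, Max S}"
    and edge: "(v, p) \<in> edges (cycle_tree f S s)"
  shows "v < p \<longleftrightarrow> v < f v"
proof -
  have "v \<in> S" and "v \<noteq> s"
    using edge edges_subset_set_rtree [of "cycle_tree f S s"] set_cycle_tree [OF cyc s(1)]
      simple_cycle_tree [OF cyc s(1)] root_cycle_tree [of f S s]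
    by (blast, metis DomainI simple_tree_def)
  then have "v \<in> set (cycle_word f S s)"
    using distinct_cycle_word(2) [OF cyc s(1)] by auto
  then obtain xs ys where "cycle_word f S s = xs @ v # ys" by (meson split_list)
  \<comment> \<open>For empty \<open>ys\<close> the successor \<open>u\<close> is the appended mark
    \<open>s\<close>.\<close>
  moreover obtain u zs where "ys @ [s] = u # zs" by (cases ys) auto
  ultimately have B: "cycle_word f S s @ [s] = xs @ v # u # zs" by simp
  have "v < p \<longleftrightarrow> v < u"
  proof (rule word_tree_excedance [OF _ _ B])
    show "last (cycle_word f S s @ [s]) \<in>
        {Min (set (cycle_word f S s @ [s])), Max (set (cycle_word f S s @ [s]))}"
      unfolding distinct_cycle_word(2) [OF cyc s(1)] using s(2) by simp
  qed (use distinct_cycle_word(1) [OF cyc s(1)] edge cycle_tree_cyclic [OF cyc s(1)] in simp_all)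
  then show ?thesis using cycle_word_adjacent [OF cyc s(1) B] by simp
qed


section \<open>The tree of a colored permutation\<close>

lemma cycle_supports_cyclic:
  assumes "\<sigma> permutes {1..n}" and "C \<in> cycle_supports n \<sigma>"
  shows "cyclic_on \<sigma> C" and "C \<subseteq> {1..n}" and "finite C" and "C \<noteq> {}"
proof -
  obtain x where x: "x \<in> {1..n}" "C = orbit \<sigma> x"
    using assms(2) unfolding cycle_supports_def by blast
  show "cyclic_on \<sigma> C" unfolding x(2) using assms(1) by (rule cyclic_on_orbit) simp
  show "C \<subseteq> {1..n}" unfolding x(2) using assms(1) x(1) by (rule permutes_orbit_subset)
  then show "finite C" by (rule finite_subset) simp
  show "C \<noteq> {}" unfolding x(2) by (rule orbit_nonempty)
qed

lemma cycle_supports_disjoint: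
  assumes "\<sigma> permutes {1..n}" and "C \<in> cycle_supports n \<sigma>" and "D \<in> cycle_supports n \<sigma>"
    and "x \<in> C" and "x \<in> D"
  shows "C = D"
  using orbit_cyclic_eq3 [OF cycle_supports_cyclic(1) [OF assms(1,2)] assms(4)]
    orbit_cyclic_eq3 [OF cycle_supports_cyclic(1) [OF assms(1,3)] assms(5)] by simp

theorem theorem4p1:
  fixes n r :: nat and \<pi> :: colored_perm and \<T> :: colored_tree
  assumes "r \<ge> 2"
    and "\<pi> \<in> colored_perms r n"
    and "\<T> = T'' n \<pi>"
  shows "(indicator_vec n (tree_excedances n \<T>), c\<^sub>0 \<T>, c\<^sub>1 n \<T>, yy n \<T>)
       = (indicator_vec n (excedances n \<pi>), int (zc n \<pi>), nc n \<pi>, yy_perm n \<pi>)"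
proof -
  obtain \<kappa> \<sigma> where \<pi>: "\<pi> = (\<kappa>, \<sigma>)" and \<sigma>: "\<sigma> permutes {1..n}"
    using assms(2) unfolding colored_perms_def by auto
  define Z where "Z = zero_cycles n (\<kappa>, \<sigma>)"
  define N where "N = nonzero_cycles n (\<kappa>, \<sigma>)"
  define zt where "zt = (\<lambda>C. cycle_tree (perm_restrict \<sigma> C) C (Max C))"
  define nt where "nt = (\<lambda>C. cycle_tree (perm_restrict \<sigma> C) C (Min C))"
  define t1 where "t1 = Node (n + 1) (Abs_fset (nt ` N))"
  define t0 where "t0 = Node 0 (finsert t1 (Abs_fset (zt ` Z)))"
  have \<T>: "fst \<T> = t0"
    by (simp add: assms(3) \<pi> t0_def t1_def zt_def nt_def Z_def N_def)
  have supp: "Z \<union> N = cycle_supports n \<sigma>" "Z \<inter> N = {}"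
    by (auto simp: Z_def N_def)
  have fin: "finite Z" "finite N"
    using supp(1) by (simp_all add: Z_def N_def cycle_supports_def)
  \<comment> \<open>\<open>Abs_fset\<close> returns the intended sets of subtrees because there are
    finitely many cycles.\<close>
  then have fset_t1: "fset (Abs_fset (nt ` N)) = nt ` N"
    and fset_t0: "fset (finsert t1 (Abs_fset (zt ` Z))) = insert t1 (zt ` Z)"
    by (simp_all add: Abs_fset_inverse)
  have cyc: "cyclic_on \<sigma> C" "cyclic_on (perm_restrict \<sigma> C) C" "C \<subseteq> {1..n}"
      "Min C \<in> C" "Max C \<in> C" "finite C"
    if "C \<in> Z \<union> N" for C
    using cycle_supports_cyclic [OF \<sigma> that [unfolded supp(1)]]
    by (simp_all only: cyclic_on_perm_restrict Min_in Max_in not_False_eq_True simp_thms)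
  have disj: "C = D" if "C \<in> Z \<union> N" "D \<in> Z \<union> N" "x \<in> C" "x \<in> D" for C D x
    using cycle_supports_disjoint [OF \<sigma>] that unfolding supp(1) by this
  have zt: "root (zt C) = Max C" "set_rtree (zt C) = C" "simple_tree (zt C)" if "C \<in> Z" for C
    using that root_cycle_tree set_cycle_tree [OF cyc(2,5)] simple_cycle_tree [OF cyc(2,5)]
    unfolding zt_def by simp_all
  have nt: "root (nt C) = Min C" "set_rtree (nt C) = C" "simple_tree (nt C)" if "C \<in> N" for C
    using that root_cycle_tree set_cycle_tree [OF cyc(2,4)] simple_cycle_tree [OF cyc(2,4)]
    unfolding nt_def by simp_all
  have bounds: "0 \<notin> C" "n + 1 \<notin> C" if "C \<in> Z \<union> N" for C
    using cyc(3) [OF that] by auto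
  have set_t1: "set_rtree t1 = insert (n + 1) (\<Union>N)"
    using nt(2) unfolding t1_def set_rtree_Node fset_t1 by simp
  have root_t1: "root t1 = n + 1" by (simp add: t1_def)
  \<comment> \<open>Simplicity is assembled upwards, from the cycle trees to \<open>t1\<close> and
    then to \<open>t0\<close>; disjointness of distinct cycles keeps the label sets apart.\<close>
  have "simple_tree t1"
    unfolding t1_def
  proof (rule simple_tree_Node, unfold fset_t1)
    show "disjoint_forest (nt ` N)"
    proof (rule disjoint_forest_image)
      show "C = D" if "C \<in> N" "D \<in> N" "x \<in> set_rtree (nt C)" "x \<in> set_rtree (nt D)" for C D x
        using that disj [of C D x] by (simp add: nt(2))
    qed
    show "simple_tree t" "n + 1 \<notin> set_rtree t" if "t \<in> nt ` N" for t
      using that nt(2,3) bounds(2) by auto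
  qed
  have notin_t1: "x \<notin> set_rtree t1" if "C \<in> Z" "x \<in> C" for C x
  proof
    assume "x \<in> set_rtree t1"
    moreover have "x \<noteq> n + 1" using bounds(2) that by blast
    ultimately obtain D where "D \<in> N" "x \<in> D" unfolding set_t1 by blast
    then show False using disj [of C D x] that supp(2) by blast
  qed
  have zero_notin: "0 \<notin> set_rtree t" if "t \<in> insert t1 (zt ` Z)" for t
    using that set_t1 zt(2) bounds(1) by auto
  have "simple_tree t0"
    unfolding t0_def
  proof (rule simple_tree_Node, unfold fset_t0)
    show "disjoint_forest (insert t1 (zt ` Z))"
    proof (intro disjoint_forest_insert disjoint_forest_image)
      show "C = D" if "C \<in> Z" "D \<in> Z" "x \<in> set_rtree (zt C)" "x \<in> set_rtree (zt D)" for C D x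
        using that disj [of C D x] by (simp add: zt(2))
      show "x \<notin> set_rtree t" if "t \<in> zt ` Z" "x \<in> set_rtree t1" for t x
        using that notin_t1 zt(2) by auto
    qed
    show "simple_tree t" if "t \<in> insert t1 (zt ` Z)" for t
      using that \<open>simple_tree t1\<close> zt(3) by auto
  qed (rule zero_notin)
  then have sv: "single_valued (edges t0)" by (simp add: simple_tree_def)
  \<comment> \<open>With all edges listed, a parent can be found by membership, and
    \<open>sv\<close> makes it the value of \<open>parent\<close>.\<close>
  have edges_t0: "edges t0 =
      insert (n + 1, 0) ((\<lambda>C. (Max C, 0)) ` Z) \<union>
      ((((\<lambda>C. (Min C, n + 1)) ` N) \<union> (\<Union>C\<in>N. edges (nt C))) \<union> (\<Union>C\<in>Z. edges (zt C)))"
  proof -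
    have "edges t1 = ((\<lambda>C. (Min C, n + 1)) ` N) \<union> (\<Union>C\<in>N. edges (nt C))"
      unfolding t1_def edges_Node fset_t1 image_image by (simp add: nt(1) cong: image_cong)
    moreover have "edges t0 = insert (n + 1, 0) ((\<lambda>C. (Max C, 0)) ` Z)
        \<union> (edges t1 \<union> (\<Union>C\<in>Z. edges (zt C)))"
      unfolding t0_def edges_Node fset_t0 image_insert image_image
      by (simp add: zt(1) root_t1 cong: image_cong)
    ultimately show ?thesis by (simp only:)
  qed
  \<comment> \<open>Disjoint cycles have different extremal elements, so counting marked children
    amounts to counting cycles.\<close>
  have inj: "inj_on Max (Z \<union> N)" "inj_on Min (Z \<union> N)"
  proof (rule_tac [!] inj_onI)
    fix C D assume CD: "C \<in> Z \<union> N" "D \<in> Z \<union> N"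
    show "C = D" if "Max C = Max D"
      using disj [OF CD, of "Max C"] cyc(5) [OF CD(1)] cyc(5) [OF CD(2)] that by simp
    show "C = D" if "Min C = Min D"
      using disj [OF CD, of "Min C"] cyc(4) [OF CD(1)] cyc(4) [OF CD(2)] that by simp
  qed
  \<comment> \<open>The child \<open>n + 1\<close> is not the maximum of a cycle and accounts for
    the one subtracted in \<open>c\<^sub>0\<close>.\<close>
  have "children t0 0 = insert (n + 1) (Max ` Z)"
    using children_root [of "finsert t1 (Abs_fset (zt ` Z))" 0] zero_notin zt(1) root_t1
    unfolding t0_def fset_t0 by force
  moreover have "n + 1 \<notin> Max ` Z" using cyc(5) bounds(2) by force
  moreover have "card (Max ` Z) = card Z"
    using inj(1) by (intro card_image) (rule inj_on_subset, auto)
  ultimately have c0: "c\<^sub>0 \<T> = int (zc n \<pi>)"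
    using fin(1) by (simp add: c\<^sub>0_def \<T> zc_def \<pi> Z_def)
  \<comment> \<open>Since \<open>n + 1\<close> lies in no cycle, it receives no edges from inside
    the cycle trees.\<close>
  have "(v, n + 1) \<notin> edges (zt C)" if "C \<in> Z" for v C
    using that edges_subset_set_rtree [of "zt C"] zt(2) bounds(2) by blast
  moreover have "(v, n + 1) \<notin> edges (nt C)" if "C \<in> N" for v C
    using that edges_subset_set_rtree [of "nt C"] nt(2) bounds(2) by blast
  ultimately have "children t0 (n + 1) = Min ` N"
    unfolding children_def edges_t0 by auto
  moreover have "card (Min ` N) = card N"
    using inj(2) by (intro card_image) (rule inj_on_subset, auto)
  ultimately have c1: "c\<^sub>1 n \<T> = nc n \<pi>"
    by (simp add: c\<^sub>1_def \<T> nc_def \<pi> N_def)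
  have exc: "i < parent t0 i \<longleftrightarrow> \<sigma> i > i \<or> \<sigma> i = i \<and> \<kappa> i \<noteq> 0" if i: "i \<in> {1..n}" for i
  proof -
    define C where "C = orbit \<sigma> i"
    have C: "C \<in> Z \<union> N" unfolding supp(1) cycle_supports_def C_def using i by blast
    have iC: "i \<in> C"
      unfolding C_def using \<sigma> permutation_permutes permutation_self_in_orbit
      by (metis finite_atLeastAtMost)
    have \<sigma>C: "\<sigma> i \<in> C" unfolding C_def by (rule orbit.base)
    have single: "C = {i}" if "\<sigma> i = i"
      using that unfolding C_def by (simp add: orbit_eq_singleton_iff)
    \<comment> \<open>Covers all unmarked vertices at once: their cycle contains both
      \<open>i\<close> and \<open>s\<close>, so \<open>i\<close> is not a fixed point and its color
      does not matter.\<close>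
    have step: "i < parent t0 i \<longleftrightarrow> \<sigma> i > i \<or> \<sigma> i = i \<and> \<kappa> i \<noteq> 0"
      if s: "s \<in> {Min C, Max C}" "i \<noteq> s"
        and sub: "edges (cycle_tree (perm_restrict \<sigma> C) C s) \<subseteq> edges t0" for s
    proof -
      have sC: "s \<in> C" using s(1) cyc(4,5) [OF C] by blast
      obtain p where p: "(i, p) \<in> edges (cycle_tree (perm_restrict \<sigma> C) C s)"
        using child_or_root [of i "cycle_tree (perm_restrict \<sigma> C) C s"] iC s(2)
          set_cycle_tree [OF cyc(2) [OF C] sC] root_cycle_tree by blast
      then have "parent t0 i = p" using parent_eq [OF sv] sub by blast
      moreover have "i < p \<longleftrightarrow> i < \<sigma> i"
        using cycle_tree_excedance [OF cyc(2) [OF C] sC s(1) p] iC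
        by (simp add: perm_restrict_simps)
      moreover have "\<sigma> i \<noteq> i" using single s(2) sC by blast
      ultimately show ?thesis by simp
    qed
    from C consider "C \<in> Z" | "C \<in> N" by blast
    then show ?thesis
    proof cases
      case 1
      show ?thesis
      proof (cases "i = Max C")
        case True
        then have "(i, 0) \<in> edges t0" unfolding edges_t0 using 1 by blast
        then have "parent t0 i = 0" using parent_eq [OF sv] by blast
        \<comment> \<open>At the maximum of a zero cycle both sides fail; a fixed point is excluded
          by its color 0.\<close>
        moreover have "\<sigma> i \<le> i" using True \<sigma>C cyc(6) [OF C] by simp
        moreover have "\<kappa> i = 0" using 1 True by (simp add: Z_def)
        ultimately show ?thesis by simp
      next
        case False
        have "edges (cycle_tree (perm_restrict \<sigma> C) C (Max C)) \<subseteq> edges t0"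
          unfolding edges_t0 zt_def using 1 by blast
        with False show ?thesis by (intro step [of "Max C"]) simp_all
      qed
    next
      case 2
      show ?thesis
      proof (cases "i = Min C")
        case True
        then have "(i, n + 1) \<in> edges t0" unfolding edges_t0 using 2 by blast
        then have "parent t0 i = n + 1" using parent_eq [OF sv] by blast
        moreover have "i \<le> \<sigma> i" using True \<sigma>C cyc(6) [OF C] by simp
        \<comment> \<open>At the minimum of a non-zero cycle both sides hold: if \<open>i\<close> is
          fixed, it is also the maximum of its cycle, whose color is non-zero.\<close>
        moreover have "\<kappa> i \<noteq> 0" if "\<sigma> i = i" using 2 single [OF that] by (simp add: N_def)
        ultimately show ?thesis using i by auto
      next
        case False
        have "edges (cycle_tree (perm_restrict \<sigma> C) C (Min C)) \<subseteq> edges t0"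
          unfolding edges_t0 nt_def using 2 by blast
        with False show ?thesis by (intro step [of "Min C"]) simp_all
      qed
    qed
  qed
  have "tree_excedances n \<T> = excedances n \<pi>"
    using exc by (auto simp: tree_excedances_def \<T> \<pi>)
  moreover have "yy n \<T> = yy_perm n \<pi>"
    by (simp add: yy_perm_def assms(3))
  ultimately show ?thesis using c0 c1 by simp
qed

end
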